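(* Let $C\subseteq \mathbb{R}^{\infty}$ be a $\mathrm{Sym}$-invariant cone such that $C=\mathrm{cn}(\mathrm{Sym}(A))$ for some set $A\subseteq\mathbb{R}^{\infty}_{\geq 0}$. Then every element $u\in C$ with support size $s=|\mathrm{supp}(u)|$ can be written as a conical combination (nonnegative real linear combination) of at most $s$ elements of $\mathrm{Sym}(A)$.
   Context: $\mathbb{R}^\infty$ denotes the set of real sequences $u=(u_1,u_2,\dots)$ with finitely many nonzero entries; $\mathbb{R}^\infty_{\ge0}$ those with all entries nonnegative. $\mathrm{supp}(u)=\{i: u_i\neq 0\}$. $\mathrm{Sym}=\mathrm{Sym}(\infty)$ is the group of permutations of $\mathbb{N}=\{1,2,\dots\}$ fixing all but finitely many elements, acting by $\sigma(u)=(u_{\sigma^{-1}(1)},u_{\sigma^{-1}(2)},\dots)$; for a set $A$, $\mathrm{Sym}(A)=\{\sigma(a):\sigma\in\mathrm{Sym},a\in A\}$. A set is $\mathrm{Sym}$-invariant if $\mathrm{Sym}(A)\subseteq A$. $\mathrm{cn}(A)$ is the set of all finite nonnegative real linear combinations of elements of $A$. *)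

theory Defs
  imports Complex_Main
begin

text \<open>Sequences are indexed by \<^typ>\<open>nat\<close>: the entry with index \<open>i\<close> here is \<open>u\<^sub>i\<^sub>+\<^sub>1\<close> in
  the one-based convention.\<close>

definition supp :: "(nat \<Rightarrow> real) \<Rightarrow> nat set" where
  "supp u = {i. u i \<noteq> 0}"

definition R_inf :: "(nat \<Rightarrow> real) set" where
  "R_inf = {u. finite (supp u)}"

definition R_inf_nonneg :: "(nat \<Rightarrow> real) set" where
  "R_inf_nonneg = {u \<in> R_inf. \<forall>i. 0 \<le> u i}"

definition Sym_inf :: "(nat \<Rightarrow> nat) set" where
  "Sym_inf = {\<sigma>. bij \<sigma> \<and> finite {i. \<sigma> i \<noteq> i}}"

definition sym_act :: "(nat \<Rightarrow> nat) \<Rightarrow> (nat \<Rightarrow> real) \<Rightarrow> (nat \<Rightarrow> real)" where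
  "sym_act \<sigma> u = (\<lambda>i. u (inv \<sigma> i))"

definition Sym :: "(nat \<Rightarrow> real) set \<Rightarrow> (nat \<Rightarrow> real) set" where
  "Sym A = {sym_act \<sigma> a | \<sigma> a. \<sigma> \<in> Sym_inf \<and> a \<in> A}"

definition Sym_invariant :: "(nat \<Rightarrow> real) set \<Rightarrow> bool" where
  "Sym_invariant A \<longleftrightarrow> Sym A \<subseteq> A"

definition lin_comb :: "(nat \<Rightarrow> real) set \<Rightarrow> ((nat \<Rightarrow> real) \<Rightarrow> real) \<Rightarrow> (nat \<Rightarrow> real)" where
  "lin_comb F c = (\<lambda>i. \<Sum>v\<in>F. c v * v i)"

text \<open>The empty combination is allowed, so the zero sequence lies in \<open>cn A\<close> for every \<open>A\<close>.\<close>

definition cn :: "(nat \<Rightarrow> real) set \<Rightarrow> (nat \<Rightarrow> real) set" where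
  "cn A = {lin_comb F c | F c. finite F \<and> F \<subseteq> A \<and> (\<forall>v\<in>F. 0 \<le> c v)}"

text \<open>Cones are convex cones: subsets of \<^const>\<open>R_inf\<close> closed under conical combinations.\<close>

definition is_cone :: "(nat \<Rightarrow> real) set \<Rightarrow> bool" where
  "is_cone C \<longleftrightarrow> C \<subseteq> R_inf \<and> cn C \<subseteq> C"

end

theory Submission
  imports Defs
begin

text \<open>Take a conical representation of \<open>u\<close> with as few terms as possible. Its coefficients are
  positive and its vectors are nonnegative, so nothing cancels and each vector is supported inside
  the support of \<open>u\<close>. The vectors thus live in a space of dimension \<open>s\<close>, and if there were more
  than \<open>s\<close> of them, Caratheodory's exchange along a linear dependency would remove one.\<close>

text \<open>Gaussian elimination by induction on the equations: an equation with a nonzero entry is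
  used to eliminate one unknown, so the surplus of unknowns over equations survives.\<close>

lemma homogeneous_system_nontrivial_solution:
  fixes f :: "'a \<Rightarrow> 'b \<Rightarrow> 'c::field"
  assumes "finite S" "finite I" "card S < card I"
  shows "\<exists>d. (\<exists>i\<in>I. d i \<noteq> 0) \<and> (\<forall>s\<in>S. (\<Sum>i\<in>I. d i * f i s) = 0)"
  using assms
proof (induction S arbitrary: I f rule: finite_induct)
  case empty
  then have "I \<noteq> {}" by auto
  then show ?case by (intro exI[of _ "\<lambda>_. 1"]) auto
next
  case (insert x S)
  show ?case
  proof (cases "\<forall>i\<in>I. f i x = 0")
    case True
    obtain d where "\<exists>i\<in>I. d i \<noteq> 0" "\<forall>s\<in>S. (\<Sum>i\<in>I. d i * f i s) = 0"
      using insert.IH[of I f] insert.prems insert.hyps by auto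
    then show ?thesis using True by (intro exI[of _ d]) auto
  next
    case False
    then obtain w where w: "w \<in> I" "f w x \<noteq> 0" by blast
    \<comment> \<open>Pivot on \<open>w\<close>: the multiple of row \<open>f w\<close> is chosen so
      that column \<open>x\<close> of \<open>g\<close> vanishes, which makes equation
      \<open>x\<close> hold automatically.\<close>
    define g where "g i s = f i s - f i x / f w x * f w s" for i s
    have "card S < card (I - {w})"
      using insert.prems insert.hyps w by simp
    then obtain d where d: "\<exists>i\<in>I-{w}. d i \<noteq> 0" "\<forall>s\<in>S. (\<Sum>i\<in>I-{w}. d i * g i s) = 0"
      using insert.IH[of "I - {w}" g] insert.prems by auto
    \<comment> \<open>Back substitution: the value at \<open>w\<close> collects all the multiples of
      \<open>f w\<close> that were subtracted in \<open>g\<close>.\<close>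
    define e where "e = d(w := - (\<Sum>i\<in>I-{w}. d i * (f i x / f w x)))"
    have eq: "(\<Sum>i\<in>I. e i * f i s) = (\<Sum>i\<in>I-{w}. d i * g i s)" for s
    proof -
      have "(\<Sum>i\<in>I. e i * f i s) = e w * f w s + (\<Sum>i\<in>I-{w}. e i * f i s)"
        using insert.prems w by (simp add: sum.remove)
      also have "(\<Sum>i\<in>I-{w}. e i * f i s) = (\<Sum>i\<in>I-{w}. d i * f i s)"
        by (intro sum.cong) (auto simp: e_def)
      also have "e w * f w s + \<dots> = (\<Sum>i\<in>I-{w}. d i * g i s)"
        by (simp add: e_def g_def right_diff_distrib sum_subtractf sum_distrib_right mult.assoc)
      finally show ?thesis .
    qed
    have "g i x = 0" for i using w by (simp add: g_def)
    then have "\<forall>s\<in>insert x S. (\<Sum>i\<in>I. e i * f i s) = 0"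
      using d(2) by (simp add: eq)
    moreover have "\<exists>i\<in>I. e i \<noteq> 0" using d(1) by (auto simp: e_def)
    ultimately show ?thesis by blast
  qed
qed

lemma lin_comb_remove:
  assumes "finite F" "c w = 0"
  shows "lin_comb (F - {w}) c = lin_comb F c"
  unfolding lin_comb_def using assms by (intro ext sum.mono_neutral_left) auto

text \<open>Subtracting a multiple of a linear relation from the coefficients leaves the combination
  unchanged. The multiple is taken just large enough for one coefficient to reach zero while none
  becomes negative.\<close>

lemma lin_comb_drop_of_dependent:
  assumes fin: "finite F" and nonneg: "\<forall>v\<in>F. 0 \<le> c v"
    and dep: "lin_comb F d = (\<lambda>_. 0)" and nz: "\<exists>v\<in>F. d v \<noteq> 0"
  shows "\<exists>w\<in>F. \<exists>c'. (\<forall>v\<in>F - {w}. 0 \<le> c' v) \<and> lin_comb F c = lin_comb (F - {w}) c'"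
proof -
  \<comment> \<open>A relation may be negated, so some coefficient can be assumed positive.\<close>
  obtain e where e: "lin_comb F e = (\<lambda>_. 0)" "\<exists>v\<in>F. e v > 0"
  proof (cases "\<exists>v\<in>F. d v > 0")
    case False
    have "lin_comb F (\<lambda>v. - d v) = (\<lambda>_. 0)"
      using dep by (simp add: lin_comb_def fun_eq_iff sum_negf)
    moreover have "\<exists>v\<in>F. - d v > 0" using False nz by force
    ultimately show ?thesis by (rule that)
  qed (use dep that in blast)
  define P where "P = {v\<in>F. e v > 0}"
  \<comment> \<open>Only coefficients in \<open>P\<close> can decrease when a nonnegative multiple
    of \<open>e\<close> is subtracted; the smallest ratio belongs to one that reaches zero
    first.\<close>
  define w where "w = arg_min_on (\<lambda>v. c v / e v) P"
  have P: "finite P" "P \<noteq> {}" using fin e(2) by (auto simp: P_def)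
  have w: "w \<in> P" and least: "\<And>v. v \<in> P \<Longrightarrow> c w / e w \<le> c v / e v"
    unfolding w_def using arg_min_if_finite(1)[OF P] arg_min_least[OF P] by auto
  have wF: "w \<in> F" "e w > 0" using w by (auto simp: P_def)
  define c' where "c' v = c v - c w / e w * e v" for v
  have "0 \<le> c' v" if "v \<in> F" for v
  proof (cases "e v > 0")
    case True
    then have "c w / e w \<le> c v / e v" using that least by (simp add: P_def)
    then show ?thesis using True by (simp add: c'_def pos_le_divide_eq)
  next
    case False
    have "0 \<le> c w / e w" using nonneg wF by simp
    then have "c w / e w * e v \<le> 0" using False by (intro mult_nonneg_nonpos) auto
    moreover have "0 \<le> c v" using nonneg that by blast
    ultimately show ?thesis by (simp add: c'_def)
  qed
  moreover have "lin_comb (F - {w}) c' = lin_comb F c"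
  proof -
    have "lin_comb F c' i = lin_comb F c i - c w / e w * lin_comb F e i" for i
      by (simp add: lin_comb_def c'_def left_diff_distrib sum_subtractf sum_distrib_left mult.assoc)
    then have "lin_comb F c' = lin_comb F c" using e(1) by auto
    moreover have "c' w = 0" using wF by (simp add: c'_def)
    ultimately show ?thesis using lin_comb_remove fin by metis
  qed
  ultimately show ?thesis using wF by (metis DiffD1)
qed

lemma supp_subset_supp_lin_comb:
  assumes "finite F" "\<forall>v\<in>F. 0 < c v" "\<forall>v\<in>F. \<forall>i. 0 \<le> v i" "v \<in> F"
  shows "supp v \<subseteq> supp (lin_comb F c)"
proof
  fix i assume "i \<in> supp v"
  then have "0 < v i" using assms(3,4) by (auto simp: supp_def less_le)
  then have "0 < c v * v i" using assms by simp
  then have "0 < (\<Sum>v\<in>F. c v * v i)"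
    using assms by (intro sum_pos2[of F v]) (auto simp: less_imp_le)
  then show "i \<in> supp (lin_comb F c)" by (simp add: supp_def lin_comb_def)
qed

theorem theorem3p1:
  fixes C A :: "(nat \<Rightarrow> real) set"
  assumes "is_cone C"
    and "Sym_invariant C"
    and "A \<subseteq> R_inf_nonneg"
    and "C = cn (Sym A)"
  shows "\<forall>u\<in>C. \<exists>F c. finite F \<and> F \<subseteq> Sym A \<and> card F \<le> card (supp u)
           \<and> (\<forall>v\<in>F. 0 \<le> c v) \<and> u = lin_comb F c"
proof
  fix u assume u: "u \<in> C"
  define rep where "rep F c \<longleftrightarrow> finite F \<and> F \<subseteq> Sym A \<and> (\<forall>v\<in>F. 0 \<le> c v) \<and> u = lin_comb F c"
    for F c
  have "\<exists>F c. rep F c" using u assms(4) by (auto simp: cn_def rep_def)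
  \<comment> \<open>Minimality ranges over all generating sets and all coefficients at once, so it
    also rules out smaller sets with changed coefficients.\<close>
  then obtain F where F: "\<exists>c. rep F c" and least: "\<And>G c. rep G c \<Longrightarrow> card F \<le> card G"
    using exists_least_iff[of "\<lambda>n. \<exists>F. (\<exists>c. rep F c) \<and> card F = n"]
    by (metis not_le)
  from F obtain c where "rep F c" by blast
  then have fin: "finite F" and FA: "F \<subseteq> Sym A" and c: "\<forall>v\<in>F. 0 \<le> c v" and uF: "u = lin_comb F c"
    by (auto simp: rep_def)
  have no_drop: False
    if "w \<in> F" "\<forall>v\<in>F-{w}. 0 \<le> c' v" "u = lin_comb (F - {w}) c'" for w c'
  proof -
    have "rep (F - {w}) c'" using that fin FA by (auto simp: rep_def)
    then have "card F \<le> card (F - {w})" by (rule least)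
    then show False using that(1) fin card_Diff1_less[of F w] by simp
  qed
  have pos: "\<forall>v\<in>F. 0 < c v"
  proof (intro ballI, rule ccontr)
    fix w assume w: "w \<in> F" "\<not> 0 < c w"
    then have "c w = 0" using c by force
    then have "u = lin_comb (F - {w}) c" using lin_comb_remove[OF fin] uF by simp
    then show False using no_drop[OF w(1)] c by blast
  qed
  \<comment> \<open>Permuting the entries of a vector of \<open>A\<close> keeps them
    nonnegative.\<close>
  have nonneg: "\<forall>v\<in>F. \<forall>i. 0 \<le> v i"
    using FA assms(3) by (force simp: Sym_def sym_act_def R_inf_nonneg_def)
  have supp_F: "supp v \<subseteq> supp u" if "v \<in> F" for v
    using supp_subset_supp_lin_comb[OF fin pos nonneg that] uF by simp
  have fin_u: "finite (supp u)" using u assms(1) by (auto simp: is_cone_def R_inf_def)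
  have "card F \<le> card (supp u)"
  proof (rule ccontr)
    assume "\<not> card F \<le> card (supp u)"
    \<comment> \<open>One unknown per vector of \<open>F\<close>, one equation per index in
      \<open>supp u\<close>.\<close>
    then obtain d where d: "\<exists>v\<in>F. d v \<noteq> 0" "\<forall>i\<in>supp u. (\<Sum>v\<in>F. d v * v i) = 0"
      using homogeneous_system_nontrivial_solution[OF fin_u fin, of "\<lambda>v i. v i"] by auto
    have "lin_comb F d i = 0" for i
    proof (cases "i \<in> supp u")
      case False
      \<comment> \<open>Off \<open>supp u\<close> all vectors of \<open>F\<close> vanish, so the
        finitely many equations already give a relation between whole sequences.\<close>
      then have "\<forall>v\<in>F. v i = 0" using supp_F by (auto simp: supp_def)
      then show ?thesis by (auto simp: lin_comb_def intro!: sum.neutral)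
    qed (use d in \<open>simp add: lin_comb_def\<close>)
    then have "lin_comb F d = (\<lambda>_. 0)" by auto
    from lin_comb_drop_of_dependent[OF fin c this d(1)] no_drop uF show False by metis
  qed
  then show "\<exists>F c. finite F \<and> F \<subseteq> Sym A \<and> card F \<le> card (supp u)
           \<and> (\<forall>v\<in>F. 0 \<le> c v) \<and> u = lin_comb F c"
    using fin FA c uF by blast
qed

end
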